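(* There is an absolute constant $C>0$ such that the following holds. Let $p$ be a prime, let $\mathcal{X}\subset\{0,1,\ldots,p-1\}$, and let $\Delta\ge 0$ be a real number such that $$\max_{(a,p)=1}\left|\sum_{x\in\mathcal{X}}e^{\frac{2\pi i a x}{p}}\right|\le|\mathcal{X}|\Delta,$$ where the maximum is over integers $a$ coprime to $p$ and $|\mathcal{X}|$ denotes the number of elements of $\mathcal{X}$. Let $S$ and $T$ be any integers with $1\le T\le p$, and let $J_3$ denote the number of pairs of integers $(x,y)$ satisfying $$x\equiv y\pmod p,\qquad x\in\mathcal{X},\quad S+1\le y\le S+T.$$ Then $$\left|J_3-\frac{|\mathcal{X}|T}{p}\right|\le C\left(\frac{|\mathcal{X}|T^{1/3}\Delta^{2/3}}{p^{1/3}}+|\mathcal{X}|\Delta\right).$$ *)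

theory Defs
  imports "HOL-Analysis.Analysis" "HOL-Number_Theory.Number_Theory"
begin

definition exp_sum :: "nat \<Rightarrow> int set \<Rightarrow> int \<Rightarrow> complex" where
  "exp_sum p X a = (\<Sum>x\<in>X. exp (2 * of_real pi * \<i> * of_int a * of_int x / of_nat p))"

definition exp_sum_norms :: "nat \<Rightarrow> int set \<Rightarrow> real set" where
  "exp_sum_norms p X = {norm (exp_sum p X a) | a. coprime a (int p)}"

definition max_exp_sum :: "nat \<Rightarrow> int set \<Rightarrow> real" where
  "max_exp_sum p X = Max (exp_sum_norms p X)"

text \<open>The index \<open>a\<close> ranges over infinitely many integers, so the use of \<^const>\<open>Max\<close> needs
  justification: by periodicity modulo \<open>p\<close> only finitely many values occur.\<close>

lemma exp_sum_mod:
  assumes "p > 0"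
  shows "exp_sum p X (a mod int p) = exp_sum p X a"
  unfolding exp_sum_def
proof (intro sum.cong refl)
  fix x
  have "2 * of_real pi * \<i> * of_int a * of_int x / of_nat p
      = 2 * of_real pi * \<i> * of_int (a mod int p) * of_int x / of_nat p
        + 2 * of_int (a div int p * x) * of_real pi * \<i>"
  proof -
    have "(of_int a :: complex) = of_int (a div int p) * of_nat p + of_int (a mod int p)"
      by (metis div_mult_mod_eq of_int_add of_int_mult of_int_of_nat_eq)
    then show ?thesis
      using assms by (simp add: field_simps)
  qed
  moreover have "exp (2 * of_int (a div int p * x) * of_real pi * \<i>) = (1 :: complex)"
    using exp_integer_2pi[of "of_int (a div int p * x)"] by (simp add: mult_ac)
  ultimately show "exp (2 * of_real pi * \<i> * of_int (a mod int p) * of_int x / of_nat p)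
      = exp (2 * of_real pi * \<i> * of_int a * of_int x / of_nat p)"
    by (simp add: exp_add)
qed

lemma exp_sum_norms_finite_nonempty:
  assumes "p > 0"
  shows "finite (exp_sum_norms p X)" "exp_sum_norms p X \<noteq> {}"
proof -
  have "exp_sum_norms p X \<subseteq> (\<lambda>a. norm (exp_sum p X a)) ` {0..<int p}"
  proof
    fix r assume "r \<in> exp_sum_norms p X"
    then obtain a where "r = norm (exp_sum p X a)"
      unfolding exp_sum_norms_def by blast
    then have "r = norm (exp_sum p X (a mod int p))"
      using assms by (simp add: exp_sum_mod)
    moreover have "a mod int p \<in> {0..<int p}"
      using assms by simp
    ultimately show "r \<in> (\<lambda>a. norm (exp_sum p X a)) ` {0..<int p}"
      by blast
  qed
  then show "finite (exp_sum_norms p X)"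
    by (rule finite_subset) simp
  have "norm (exp_sum p X 1) \<in> exp_sum_norms p X"
    unfolding exp_sum_norms_def by force
  then show "exp_sum_norms p X \<noteq> {}"
    by blast
qed

definition J3 :: "nat \<Rightarrow> int set \<Rightarrow> int \<Rightarrow> int \<Rightarrow> nat" where
  "J3 p X S T = card {(x, y). [x = y] (mod int p) \<and> x \<in> X \<and> S + 1 \<le> y \<and> y \<le> S + T}"

end

theory Submission
  imports Defs
begin

text \<open>Compare the interval \<open>{S+1..S+T}\<close> from above and from below with convolutions of intervals with
  \<open>{0..<H}\<close>. The Fourier coefficients of such a convolution are products, so Cauchy--Schwarz and
  Parseval bound the sum of their absolute values without a logarithmic loss: the error is at most
  \<open>|X| H / p + |X| \<Delta> (sqrt (T / H) + 1)\<close>, and \<open>H \<approx> (\<Delta> p)\<^bsup>2/3\<^esup> T\<^bsup>1/3\<^esup>\<close> balances the terms.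
  This choice needs \<open>\<Delta> p \<ge> 1\<close>, which Parseval gives unless \<open>X\<close> is empty or everything, and
  \<open>\<Delta> < 1\<close>, the opposite case being trivial.\<close>

section \<open>Additive characters modulo \<open>p\<close>: orthogonality and Parseval\<close>

definition add_char :: "nat \<Rightarrow> int \<Rightarrow> complex" where
  "add_char p n = cis (2 * pi * real_of_int n / real p)"

lemma add_char_0 [simp]: "add_char p 0 = 1"
  by (simp add: add_char_def)

lemma add_char_add: "add_char p (m + n) = add_char p m * add_char p n"
  by (simp add: add_char_def cis_mult add_divide_distrib distrib_left)

lemma add_char_power: "add_char p (int k * n) = add_char p n ^ k"
  by (simp add: add_char_def Complex.DeMoivre mult_ac)

lemma cnj_add_char: "cnj (add_char p n) = add_char p (- n)"
  by (simp add: add_char_def cis_cnj)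

lemma add_char_eq_1_iff:
  assumes "p > 0"
  shows "add_char p n = 1 \<longleftrightarrow> int p dvd n"
proof
  assume "add_char p n = 1"
  then have "cos (2 * pi * real_of_int n / real p) = 1"
    by (simp add: add_char_def complex_eq_iff)
  then obtain k :: int where "2 * pi * real_of_int n / real p = of_int k * 2 * pi"
    using cos_one_2pi_int by auto
  then have "real_of_int n = real_of_int (k * int p)"
    using assms by (simp add: field_simps)
  then show "int p dvd n"
    unfolding of_int_eq_iff by simp
next
  assume "int p dvd n"
  then obtain k where "n = int p * k" ..
  then have "2 * pi * real_of_int n / real p = 2 * pi * of_int k"
    using assms by simp
  then show "add_char p n = 1"
    unfolding add_char_def by (simp add: cis_multiple_2pi)
qed

text \<open>Orthogonality: the sum is geometric with ratio \<open>add_char p n\<close>, a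
  \<open>p\<close>-th root of unity, which equals 1 exactly when \<open>p\<close> divides
  \<open>n\<close>.\<close>

lemma sum_add_char:
  assumes "p > 0"
  shows "(\<Sum>a<p. add_char p (int a * n)) = of_nat p * of_bool (int p dvd n)"
proof (cases "int p dvd n")
  case True
  then show ?thesis
    using assms by (simp add: add_char_power add_char_eq_1_iff[THEN iffD2])
next
  case False
  then have "add_char p n \<noteq> 1"
    using assms by (simp add: add_char_eq_1_iff)
  moreover have "add_char p n ^ p = 1"
    using assms by (simp flip: add_char_power add: add_char_eq_1_iff)
  ultimately show ?thesis
    using False by (simp add: add_char_power sum_gp_strict)
qed

lemma exp_sum_eq_sum_add_char: "exp_sum p X a = (\<Sum>x\<in>X. add_char p (a * x))"
  by (simp add: exp_sum_def add_char_def cis_conv_exp mult_ac)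

lemma exp_sum_0 [simp]: "exp_sum p X 0 = of_nat (card X)"
  by (simp add: exp_sum_eq_sum_add_char)

text \<open>Expand each square into a double sum over \<open>A\<close> and sum over \<open>a\<close>
  first. Since \<open>A\<close> has distinct residues, orthogonality leaves only the
  diagonal.\<close>

lemma exp_sum_parseval:
  assumes "p > 0" "finite A" "inj_on (\<lambda>x. x mod int p) A"
  shows "(\<Sum>a<p. (norm (exp_sum p A (int a)))\<^sup>2) = real p * real (card A)"
proof -
  have "complex_of_real (\<Sum>a<p. (norm (exp_sum p A (int a)))\<^sup>2)
      = (\<Sum>a<p. \<Sum>x\<in>A. \<Sum>y\<in>A. add_char p (int a * (x - y)))"
    by (simp add: complex_norm_square exp_sum_eq_sum_add_char sum_product cnj_add_char
        add_char_add[symmetric] algebra_simps del: of_real_power)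
  also have "\<dots> = (\<Sum>x\<in>A. \<Sum>y\<in>A. \<Sum>a<p. add_char p (int a * (x - y)))"
    by (subst sum.swap, rule sum.cong[OF refl], rule sum.swap)
  also have "\<dots> = (\<Sum>x\<in>A. \<Sum>y\<in>A. if x = y then of_nat p else 0)"
  proof (intro sum.cong refl)
    fix x y assume "x \<in> A" "y \<in> A"
    then have "int p dvd x - y \<longleftrightarrow> x = y"
      using assms(3) by (auto simp: inj_on_def mod_eq_dvd_iff)
    then show "(\<Sum>a<p. add_char p (int a * (x - y))) = (if x = y then of_nat p else 0)"
      using assms(1) by (simp add: sum_add_char)
  qed
  also have "\<dots> = complex_of_real (real p * real (card A))"
    using assms(2) by simp
  finally show ?thesis
    unfolding of_real_eq_iff .
qed

section \<open>Fourier analysis of congruences \<open>x = u + h\<close>\<close>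

definition cong_count :: "nat \<Rightarrow> int set \<Rightarrow> int set \<Rightarrow> int set \<Rightarrow> real" where
  "cong_count p X A B = (\<Sum>x\<in>X. \<Sum>h\<in>B. \<Sum>u\<in>A. of_bool [x = u + h] (mod int p))"

text \<open>Detect each congruence by orthogonality and move the sum over \<open>a\<close> outside.
  The character of \<open>x - h - u\<close> then factors, so the convolution of \<open>A\<close> and
  \<open>B\<close> becomes a product of Fourier coefficients.\<close>

lemma cong_count_eq_exp_sum:
  assumes "p > 0"
  shows "of_nat p * complex_of_real (cong_count p X A B)
    = (\<Sum>a<p. exp_sum p X (int a) * cnj (exp_sum p B (int a)) * cnj (exp_sum p A (int a)))"
proof -
  have "complex_of_real (of_bool P) = of_bool P" for P
    by (cases P) simp_all
  then have "of_nat p * complex_of_real (cong_count p X A B)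
      = (\<Sum>x\<in>X. \<Sum>h\<in>B. \<Sum>u\<in>A. of_nat p * of_bool (int p dvd x - h - u))"
    by (simp add: cong_count_def sum_distrib_left cong_iff_dvd_diff algebra_simps)
  also have "\<dots> = (\<Sum>x\<in>X. \<Sum>h\<in>B. \<Sum>u\<in>A. \<Sum>a<p. add_char p (int a * (x - h - u)))"
    using assms by (simp add: sum_add_char)
  also have "\<dots> = (\<Sum>x\<in>X. \<Sum>h\<in>B. \<Sum>a<p. \<Sum>u\<in>A. add_char p (int a * (x - h - u)))"
    by (intro sum.cong refl sum.swap)
  also have "\<dots> = (\<Sum>x\<in>X. \<Sum>a<p. \<Sum>h\<in>B. \<Sum>u\<in>A. add_char p (int a * (x - h - u)))"
    by (intro sum.cong refl sum.swap)
  also have "\<dots> = (\<Sum>a<p. \<Sum>x\<in>X. \<Sum>h\<in>B. \<Sum>u\<in>A. add_char p (int a * (x - h - u)))"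
    by (rule sum.swap)
  also have "\<dots> = (\<Sum>a<p. exp_sum p X (int a) * cnj (exp_sum p B (int a))
      * cnj (exp_sum p A (int a)))"
  proof (rule sum.cong[OF refl])
    fix a
    have "add_char p (int a * (x - h - u))
        = add_char p (int a * x) * cnj (add_char p (int a * h)) * cnj (add_char p (int a * u))"
      for x h u
      by (simp add: cnj_add_char add_char_add[symmetric] algebra_simps)
    then show "(\<Sum>x\<in>X. \<Sum>h\<in>B. \<Sum>u\<in>A. add_char p (int a * (x - h - u)))
        = exp_sum p X (int a) * cnj (exp_sum p B (int a)) * cnj (exp_sum p A (int a))"
      by (simp add: exp_sum_eq_sum_add_char flip: sum_distrib_left sum_distrib_right)
  qed
  finally show ?thesis .
qed

text \<open>The frequency \<open>a = 0\<close> gives the expected value. At the others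
  \<open>M\<close> bounds the coefficient of \<open>X\<close>, and Cauchy--Schwarz with Parseval
  bounds the sum of the remaining products by \<open>p * sqrt (card A * card B)\<close>.\<close>

lemma cong_count_approx:
  assumes "p > 0" and "finite A" "inj_on (\<lambda>x. x mod int p) A"
    and "finite B" "inj_on (\<lambda>x. x mod int p) B"
    and "M \<ge> 0" and M: "\<And>a. 0 < a \<Longrightarrow> a < p \<Longrightarrow> norm (exp_sum p X (int a)) \<le> M"
  shows "\<bar>cong_count p X A B - real (card X) * real (card A) * real (card B) / real p\<bar>
    \<le> M * sqrt (real (card A) * real (card B))"
proof -
  define E where "E Y a = exp_sum p Y (int a)" for Y a
  define f where "f a = E X a * cnj (E B a) * cnj (E A a)" for a
  let ?D = "cong_count p X A B - real (card X) * real (card A) * real (card B) / real p"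
  have "{..<p} = insert 0 {1..<p}"
    using \<open>p > 0\<close> by auto
  then have "(\<Sum>a<p. f a) = f 0 + (\<Sum>a\<in>{1..<p}. f a)"
    by simp
  moreover have "f 0 = of_nat (card X) * of_nat (card B) * of_nat (card A)"
    by (simp add: f_def E_def)
  ultimately have "of_nat p * complex_of_real ?D = (\<Sum>a\<in>{1..<p}. f a)"
    using cong_count_eq_exp_sum[OF \<open>p > 0\<close>, of X A B] \<open>p > 0\<close>
    by (simp add: f_def E_def algebra_simps)
  then have "real p * \<bar>?D\<bar> = norm (\<Sum>a\<in>{1..<p}. f a)"
    by (metis norm_mult norm_of_nat norm_of_real)
  also have "\<dots> \<le> (\<Sum>a\<in>{1..<p}. M * (norm (E A a) * norm (E B a)))"
  proof (intro sum_norm_le)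
    fix a assume "a \<in> {1..<p}"
    then have "norm (E X a) \<le> M"
      using M by (simp add: E_def)
    then have "norm (E X a) * (norm (E B a) * norm (E A a)) \<le> M * (norm (E B a) * norm (E A a))"
      by (intro mult_right_mono) auto
    then show "norm (f a) \<le> M * (norm (E A a) * norm (E B a))"
      by (simp add: f_def norm_mult mult_ac)
  qed
  \<comment> \<open>Restoring the nonnegative term at \<open>a = 0\<close> completes the range of
    frequencies, as Parseval requires.\<close>
  also have "\<dots> \<le> (\<Sum>a<p. M * (norm (E A a) * norm (E B a)))"
    using \<open>M \<ge> 0\<close> by (intro sum_mono2) auto
  also have "\<dots> \<le> M * (L2_set (\<lambda>a. norm (E A a)) {..<p} * L2_set (\<lambda>a. norm (E B a)) {..<p})"
    using L2_set_mult_ineq[of "\<lambda>a. norm (E A a)" "\<lambda>a. norm (E B a)" "{..<p}"] \<open>M \<ge> 0\<close>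
    by (simp add: sum_distrib_left[symmetric] mult_left_mono)
  also have "\<dots> = M * (sqrt (real p * real (card A)) * sqrt (real p * real (card B)))"
    using assms by (simp add: L2_set_def E_def exp_sum_parseval)
  also have "\<dots> = real p * (M * sqrt (real (card A) * real (card B)))"
    by (simp add: real_sqrt_mult)
  finally show ?thesis
    using \<open>p > 0\<close> by simp
qed

section \<open>Comparing the interval with convolutions of intervals\<close>

lemma inj_on_mod_interval:
  fixes a b :: int
  assumes "b - a < int p"
  shows "inj_on (\<lambda>x. x mod int p) {a..b}"
proof (rule inj_onI)
  fix x y assume xy: "x \<in> {a..b}" "y \<in> {a..b}" and "x mod int p = y mod int p"
  then have "int p dvd x - y"
    by (simp add: mod_eq_dvd_iff)
  moreover have "\<bar>x - y\<bar> < int p"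
    using xy assms by auto
  ultimately have "x - y = 0"
    using dvd_imp_le_int[of "x - y" "int p"] by (cases "x - y = 0") auto
  then show "x = y"
    by simp
qed

lemma J3_eq_sum:
  assumes "finite X"
  shows "real (J3 p X S T) = (\<Sum>x\<in>X. \<Sum>y\<in>{S+1..S+T}. of_bool [x = y] (mod int p))"
proof -
  have "{(x, y). [x = y] (mod int p) \<and> x \<in> X \<and> S + 1 \<le> y \<and> y \<le> S + T}
      = X \<times> {S+1..S+T} \<inter> {z. [fst z = snd z] (mod int p)}"
    by auto
  then have "real (J3 p X S T) = (\<Sum>z\<in>X \<times> {S+1..S+T}. of_bool [fst z = snd z] (mod int p))"
    using assms by (simp add: J3_def)
  also have "\<dots> = (\<Sum>x\<in>X. \<Sum>y\<in>{S+1..S+T}. of_bool [x = y] (mod int p))"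
    by (simp add: sum.cartesian_product case_prod_unfold del: sum_of_bool_eq)
  finally show ?thesis .
qed

lemma sum_shift_interval:
  fixes f :: "int \<Rightarrow> real"
  shows "(\<Sum>u\<in>{a..b}. f (u + h)) = (\<Sum>y\<in>{a+h..b+h}. f y)"
  by (rule sum.reindex_bij_witness[of _ "\<lambda>y. y - h" "\<lambda>u. u + h"]) auto

text \<open>For each of the \<open>H\<close> shifts \<open>h\<close>, translating the enlarged
  interval by \<open>h\<close> still covers \<open>{S+1..S+T}\<close>.\<close>

lemma J3_le_cong_count:
  assumes "finite X" "H \<ge> 0"
  shows "real_of_int H * real (J3 p X S T) \<le> cong_count p X {S-H+1..S+T} {0..<H}"
proof -
  have "real_of_int H * real (J3 p X S T)
      = (\<Sum>x\<in>X. \<Sum>h\<in>{0..<H}. \<Sum>y\<in>{S+1..S+T}. of_bool [x = y] (mod int p))"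
    using assms by (simp add: J3_eq_sum sum_distrib_left)
  also have "\<dots> \<le> cong_count p X {S-H+1..S+T} {0..<H}"
    unfolding cong_count_def
  proof (intro sum_mono)
    fix x h assume "h \<in> {0..<H}"
    then show "(\<Sum>y\<in>{S+1..S+T}. of_bool [x = y] (mod int p))
        \<le> (\<Sum>u\<in>{S-H+1..S+T}. of_bool [x = u + h] (mod int p) :: real)"
      by (subst sum_shift_interval, intro sum_mono2) auto
  qed
  finally show ?thesis .
qed

text \<open>Dually, every shift by \<open>h < H\<close> keeps the shortened interval inside
  \<open>{S+1..S+T}\<close>. For \<open>H \<ge> T\<close> the shortened interval is empty and the
  left side is 0.\<close>

lemma cong_count_le_J3:
  assumes "finite X" "H \<ge> 0"
  shows "cong_count p X {S+1..S+T-H} {0..<H} \<le> real_of_int H * real (J3 p X S T)"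
proof -
  have "cong_count p X {S+1..S+T-H} {0..<H}
      \<le> (\<Sum>x\<in>X. \<Sum>h\<in>{0..<H}. \<Sum>y\<in>{S+1..S+T}. of_bool [x = y] (mod int p))"
    unfolding cong_count_def
  proof (intro sum_mono)
    fix x h assume "h \<in> {0..<H}"
    then show "(\<Sum>u\<in>{S+1..S+T-H}. of_bool [x = u + h] (mod int p))
        \<le> (\<Sum>y\<in>{S+1..S+T}. of_bool [x = y] (mod int p) :: real)"
      by (subst sum_shift_interval, intro sum_mono2) auto
  qed
  also have "\<dots> = real_of_int H * real (J3 p X S T)"
    using assms by (simp add: J3_eq_sum sum_distrib_left)
  finally show ?thesis .
qed

text \<open>Divide both comparisons by \<open>H\<close>. The Fourier error
  \<open>M * sqrt (T * H)\<close> becomes \<open>M * sqrt (T / H)\<close>. Changing the length of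
  the interval by \<open>H\<close> shifts the main term by \<open>card X * H / p\<close>, and the
  extra block of length \<open>H\<close> in the upper comparison adds a further
  \<open>M\<close>.\<close>

lemma J3_approx:
  fixes H T S :: int
  assumes "finite X" "p > 0" and H: "1 \<le> H" "H \<le> int p" and T: "1 \<le> T" "T \<le> int p"
    and "M \<ge> 0" and M: "\<And>a. 0 < a \<Longrightarrow> a < p \<Longrightarrow> norm (exp_sum p X (int a)) \<le> M"
  shows "\<bar>real (J3 p X S T) - real (card X) * real_of_int T / real p\<bar>
    \<le> real (card X) * real_of_int H / real p + M * (sqrt (real_of_int T / real_of_int H) + 1)"
proof -
  define B where "B = {0..<H}"
  define J where "J = real (J3 p X S T)"
  define N where "N = real (card X)"
  define h where "h = real_of_int H"
  define t where "t = real_of_int T"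
  note defs = B_def J_def N_def h_def t_def
  have B: "finite B" "inj_on (\<lambda>x. x mod int p) B" "real (card B) = h"
  proof -
    have "B = {0..H-1}"
      by (auto simp: B_def)
    then show "inj_on (\<lambda>x. x mod int p) B"
      using inj_on_mod_interval[of "H-1" 0 p] H by simp
  qed (use H in \<open>auto simp: B_def h_def\<close>)
  have h: "h \<ge> 1" and t: "t \<ge> 1"
    using H T by (auto simp: h_def t_def)
  \<comment> \<open>The case \<open>a = b + 1\<close> is the empty interval, which occurs in the
    lower bound when \<open>H = T\<close>.\<close>
  have approx: "\<bar>cong_count p X {a..b} B - N * real_of_int (b - a + 1) * h / real p\<bar>
      \<le> M * sqrt (real_of_int (b - a + 1) * h)" if "b - a < int p" "a \<le> b + 1" for a b
    using cong_count_approx[of p "{a..b}" B M X] B \<open>p > 0\<close> \<open>M \<ge> 0\<close> M inj_on_mod_interval that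
    by (simp add: N_def algebra_simps)
  have sqrt_div: "sqrt (t * h) / h = sqrt (t / h)"
    using h by (simp add: real_sqrt_mult real_sqrt_divide field_simps)
  have "J - N * t / real p \<le> N * h / real p + M * (sqrt (t / h) + 1)"
  proof -
    \<comment> \<open>The enlarged interval has \<open>T + H\<close> elements, possibly more than
      \<open>p\<close>, so its residues may repeat. Each of the two pieces has at most
      \<open>p\<close> elements, and Parseval applies to it.\<close>
    have "{S-H+1..S+T} = {S-H+1..S} \<union> {S+1..S+T}" "{S-H+1..S} \<inter> {S+1..S+T} = {}"
      using H T by auto
    then have "cong_count p X {S-H+1..S+T} B
        = cong_count p X {S-H+1..S} B + cong_count p X {S+1..S+T} B"
      by (simp add: cong_count_def sum.union_disjoint sum.distrib del: sum_of_bool_eq)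
    moreover have "h * J \<le> cong_count p X {S-H+1..S+T} B"
      unfolding defs using H by (intro J3_le_cong_count \<open>finite X\<close>) simp
    ultimately have "h * J \<le> cong_count p X {S-H+1..S} B + cong_count p X {S+1..S+T} B"
      by simp
    also have "\<dots> \<le> (N * h * h / real p + M * h) + (N * t * h / real p + M * sqrt (t * h))"
      using approx[of S "S-H+1"] approx[of "S+T" "S+1"] H T h by (simp add: h_def t_def)
    finally have "h * J \<le> h * (N * h / real p + M + N * t / real p + M * (sqrt (t * h) / h))"
      using h by (simp add: algebra_simps)
    then have "J \<le> N * h / real p + M + N * t / real p + M * (sqrt (t * h) / h)"
      using h by (subst (asm) mult_le_cancel_left_pos) auto
    then show ?thesis
      unfolding sqrt_div by (simp add: algebra_simps)
  qed
  moreover have "N * t / real p - J \<le> N * h / real p + M * (sqrt (t / h) + 1)"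
  proof (cases "H \<le> T")
    case True
    have "N * (t - h) * h / real p - M * sqrt ((t - h) * h)
        \<le> cong_count p X {S+1..S+T-H} B"
      using approx[of "S+T-H" "S+1"] H T True by (simp add: h_def t_def)
    also have "\<dots> \<le> h * J"
      unfolding defs using H by (intro cong_count_le_J3 \<open>finite X\<close>) simp
    finally have "N * (t - h) * h / real p \<le> h * J + M * sqrt ((t - h) * h)"
      by simp
    also have "\<dots> \<le> h * J + M * sqrt (t * h)"
      using \<open>M \<ge> 0\<close> h by (intro add_left_mono mult_left_mono real_sqrt_le_mono mult_right_mono) auto
    finally have "h * (N * (t - h) / real p) \<le> h * (J + M * (sqrt (t * h) / h))"
      using h by (simp add: algebra_simps)
    then have "N * (t - h) / real p \<le> J + M * sqrt (t / h)"
      using h unfolding sqrt_div by (subst (asm) mult_le_cancel_left_pos) auto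
    then show ?thesis
      using \<open>M \<ge> 0\<close> by (simp add: algebra_simps diff_divide_distrib)
  next
    \<comment> \<open>Here the whole main term is at most the permitted error
      \<open>N * h / p\<close>, and \<open>J\<close> is nonnegative.\<close>
    case False
    then have "N * t / real p \<le> N * h / real p"
      by (simp add: defs divide_right_mono mult_left_mono)
    moreover have "J \<ge> 0" "M * (sqrt (t / h) + 1) \<ge> 0"
      using \<open>M \<ge> 0\<close> h t by (auto simp: J_def)
    ultimately show ?thesis
      by linarith
  qed
  ultimately show ?thesis
    by (simp add: defs abs_le_iff)
qed

section \<open>Degenerate cases and the size of the exponential sums\<close>

lemma J3_le_card:
  assumes "finite X" "T \<le> int p"
  shows "J3 p X S T \<le> card X"
proof -
  have "(\<Sum>y\<in>{S+1..S+T}. of_bool [x = y] (mod int p)) \<le> (1::real)" for x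
  proof -
    \<comment> \<open>At most \<open>p\<close> consecutive integers are pairwise incongruent, so
      each \<open>x\<close> has at most one partner.\<close>
    have "y = z" if "y \<in> {S+1..S+T}" "z \<in> {S+1..S+T}" "[x = y] (mod int p)" "[x = z] (mod int p)"
      for y z
      using inj_on_mod_interval[of "S+T" "S+1" p] that assms(2) by (auto simp: inj_on_def cong_def)
    then have "card ({S+1..S+T} \<inter> {y. [x = y] (mod int p)}) \<le> Suc 0"
      by (subst card_le_Suc0_iff_eq) auto
    then show ?thesis
      by simp
  qed
  then have "real (J3 p X S T) \<le> (\<Sum>x\<in>X. 1)"
    unfolding J3_eq_sum[OF assms(1)] by (rule sum_mono)
  then show ?thesis
    by simp
qed

text \<open>Each \<open>y\<close> has exactly one representative in the complete residue system.
  Hence the error vanishes when \<open>X\<close> is everything.\<close>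

lemma J3_full:
  assumes "p > 0" "T \<ge> 0"
  shows "real (J3 p {0..int p - 1} S T) = real_of_int T"
proof -
  have "(\<Sum>x\<in>{0..int p - 1}. of_bool [x = y] (mod int p)) = (1::real)" for y
  proof -
    have "{x \<in> {0..int p - 1}. [x = y] (mod int p)} = {y mod int p}"
      using assms(1) by (auto simp: cong_def)
    then have "card {x \<in> {0..int p - 1}. [x = y] (mod int p)} = 1"
      by simp
    then show ?thesis
      by (simp add: of_bool_def sum.If_cases Int_def)
  qed
  then show ?thesis
    using assms(2) by (subst J3_eq_sum, simp, subst sum.swap) simp
qed

text \<open>With \<open>N = card X\<close>, Parseval forces the nonzero frequencies to carry the
  mass \<open>p * N - N\<^sup>2\<close>, which is at least \<open>N\<close> because \<open>X\<close>
  is a proper nonempty subset. The bound allows them at most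
  \<open>p * (N * \<Delta>)\<^sup>2\<close>.\<close>

lemma one_le_of_exp_sum_bound:
  assumes "p > 0" and X: "X \<subseteq> {0..int p - 1}" "X \<noteq> {}" "X \<noteq> {0..int p - 1}"
    and "\<Delta> \<ge> 0"
    and bound: "\<And>a. 0 < a \<Longrightarrow> a < p \<Longrightarrow> norm (exp_sum p X (int a)) \<le> real (card X) * \<Delta>"
  shows "1 \<le> \<Delta> * real p"
proof -
  define N where "N = real (card X)"
  have fin: "finite X"
    using X(1) finite_subset by blast
  have "card X < p"
    using psubset_card_mono[of "{0..int p - 1}" X] X by auto
  moreover have "card X > 0"
    using fin X(2) by (simp add: card_gt_0_iff)
  ultimately have N: "N \<ge> 1" "N + 1 \<le> real p"
    unfolding N_def by linarith+
  have "inj_on (\<lambda>x. x mod int p) X"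
    using inj_on_mod_interval[of "int p - 1" 0 p] X(1) by (auto intro: inj_on_subset)
  then have "real p * N = (\<Sum>a<p. (norm (exp_sum p X (int a)))\<^sup>2)"
    using exp_sum_parseval fin \<open>p > 0\<close> by (simp add: N_def)
  also have "{..<p} = insert 0 {1..<p}"
    using \<open>p > 0\<close> by auto
  also have "(\<Sum>a\<in>insert 0 {1..<p}. (norm (exp_sum p X (int a)))\<^sup>2)
      = N\<^sup>2 + (\<Sum>a\<in>{1..<p}. (norm (exp_sum p X (int a)))\<^sup>2)"
    by (simp add: N_def)
  also have "(\<Sum>a\<in>{1..<p}. (norm (exp_sum p X (int a)))\<^sup>2) \<le> (\<Sum>a\<in>{1..<p}. (N * \<Delta>)\<^sup>2)"
    using bound by (intro sum_mono power_mono) (auto simp: N_def)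
  also have "\<dots> \<le> real p * (N * \<Delta>)\<^sup>2"
    using \<open>p > 0\<close> by (simp add: mult_right_mono)
  finally have "N * real p \<le> N * (N + N * (real p * \<Delta>\<^sup>2))"
    by (simp add: power2_eq_square algebra_simps)
  \<comment> \<open>Cancel \<open>N\<close> and use \<open>N + 1 \<le> p\<close>; the next step
    replaces the remaining \<open>N\<close> by \<open>p\<close> to form a perfect square.\<close>
  then have "1 \<le> N * (real p * \<Delta>\<^sup>2)"
    using N by simp
  also have "\<dots> \<le> real p * (real p * \<Delta>\<^sup>2)"
    using N by (intro mult_right_mono) auto
  finally have "1\<^sup>2 \<le> (\<Delta> * real p)\<^sup>2"
    by (simp add: power2_eq_square algebra_simps)
  then show ?thesis
    by (rule power2_le_imp_le) (simp add: \<open>\<Delta> \<ge> 0\<close>)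
qed

text \<open>Primality makes every nonzero frequency below \<open>p\<close> coprime to
  \<open>p\<close>, so the maximum controls all nontrivial terms of the Fourier expansion.\<close>

lemma norm_exp_sum_le_max:
  assumes "prime p" "0 < a" "a < p"
  shows "norm (exp_sum p X (int a)) \<le> max_exp_sum p X"
proof -
  have "\<not> p dvd a"
    using assms by (auto dest: dvd_imp_le)
  then have "coprime (int a) (int p)"
    using assms(1) by (metis coprime_commute coprime_int_iff prime_imp_coprime)
  then have "norm (exp_sum p X (int a)) \<in> exp_sum_norms p X"
    unfolding exp_sum_norms_def by blast
  then show ?thesis
    unfolding max_exp_sum_def
    using exp_sum_norms_finite_nonempty(1) assms(2,3) by (intro Max_ge) auto
qed

section \<open>Choice of the width and the final bound\<close>

lemma powr_third_cubed:
  fixes x :: real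
  assumes "x \<ge> 0"
  shows "(x powr (1/3)) ^ 3 = x"
  using assms powr_power[of x "1/3" 3] by (cases "x = 0") simp_all

text \<open>With \<open>t\<^sup>3 = T\<close>, \<open>d\<^sup>3 = \<Delta>\<close> and \<open>s\<^sup>3 = p\<close>, the width is \<open>H = \<lceil>d\<^sup>2 s\<^sup>2 t\<rceil>\<close>.\<close>

lemma J3_bound:
  fixes S T :: int
  assumes "prime p" and X: "X \<subseteq> {0..int p - 1}" and "\<Delta> \<ge> 0"
    and max: "max_exp_sum p X \<le> real (card X) * \<Delta>" and T: "1 \<le> T" "T \<le> int p"
  shows "\<bar>real (J3 p X S T) - real (card X) * real_of_int T / real p\<bar>
    \<le> 3 * (real (card X) * real_of_int T powr (1/3) * \<Delta> powr (2/3) / real p powr (1/3)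
         + real (card X) * \<Delta>)"
proof -
  have "p > 0"
    using \<open>prime p\<close> prime_gt_0_nat by blast
  define N where "N = real (card X)"
  define t where "t = real_of_int T powr (1/3)"
  define d where "d = \<Delta> powr (1/3)"
  define s where "s = real p powr (1/3)"
  define R where "R = t * d\<^sup>2 / s"
  have fin: "finite X"
    using X finite_subset by blast
  have cubes: "t ^ 3 = real_of_int T" "d ^ 3 = \<Delta>" "s ^ 3 = real p"
    unfolding t_def d_def s_def using T \<open>\<Delta> \<ge> 0\<close> by (auto intro!: powr_third_cubed)
  have t: "t \<ge> 1" and d: "d \<ge> 0" and s: "s > 0" and ts: "t \<le> s"
    using T \<open>p > 0\<close> by (auto simp: t_def d_def s_def ge_one_powr_ge_zero intro!: powr_mono2)
  have N: "N \<ge> 0" and R: "R \<ge> 0"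
    using t s by (auto simp: N_def R_def)
  have bound: "norm (exp_sum p X (int a)) \<le> N * \<Delta>" if "0 < a" "a < p" for a
    using norm_exp_sum_le_max[OF \<open>prime p\<close> that, of X] max by (simp add: N_def)
  have "\<Delta> powr (2/3) = d\<^sup>2"
    using \<open>\<Delta> \<ge> 0\<close> powr_power[of \<Delta> "1/3" 2]
    by (cases "\<Delta> = 0") (simp_all add: d_def)
  then have rhs: "3 * (real (card X) * real_of_int T powr (1/3) * \<Delta> powr (2/3) / real p powr (1/3)
         + real (card X) * \<Delta>) = 3 * (N * R + N * \<Delta>)"
    by (simp add: R_def N_def t_def s_def)
  have rhs_nonneg: "3 * (N * R + N * \<Delta>) \<ge> 0"
    using N R \<open>\<Delta> \<ge> 0\<close> by simp
  \<comment> \<open>Outside the first three cases, \<open>1 \<le> d * s\<close> and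
    \<open>d \<le> 1\<close> hold, which place the width between 1 and \<open>p\<close>.\<close>
  consider "X = {}" | "X = {0..int p - 1}" | "\<Delta> \<ge> 1"
    | (main) "X \<noteq> {}" "X \<noteq> {0..int p - 1}" "\<Delta> < 1"
    by linarith
  then have "\<bar>real (J3 p X S T) - N * real_of_int T / real p\<bar> \<le> 3 * (N * R + N * \<Delta>)"
  proof cases
    case 1
    then show ?thesis
      by (simp add: N_def J3_def)
  next
    case 2
    then have "real (J3 p X S T) = N * real_of_int T / real p"
      using J3_full[of p T S] T \<open>p > 0\<close> by (simp add: N_def)
    then show ?thesis
      using rhs_nonneg by simp
  next
    case 3
    \<comment> \<open>Both the count and its expected value lie between 0 and \<open>N\<close>, so
      they differ by at most \<open>N \<le> N * \<Delta>\<close>.\<close>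
    have "real (J3 p X S T) \<le> N"
      using J3_le_card[OF fin T(2)] by (simp add: N_def)
    moreover have "N * real_of_int T / real p \<le> N"
      using T \<open>p > 0\<close> N by (simp add: pos_divide_le_eq mult_left_mono)
    moreover have "N * real_of_int T / real p \<ge> 0"
      using T N by simp
    ultimately have "\<bar>real (J3 p X S T) - N * real_of_int T / real p\<bar> \<le> N"
      by linarith
    also have "\<dots> \<le> N * \<Delta>"
      using 3 N by (simp add: mult_le_cancel_left1)
    also have "\<dots> \<le> 3 * (N * R + N * \<Delta>)"
      using N R \<open>\<Delta> \<ge> 0\<close> by simp
    finally show ?thesis .
  next
    case main
    \<comment> \<open>This is the real width at which the errors \<open>N * K / p\<close> and
      \<open>N * \<Delta> * sqrt (T / K)\<close> both equal \<open>N * R\<close>.\<close>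
    define K where "K = (d * s)\<^sup>2 * t"
    define H where "H = \<lceil>K\<rceil>"
    have "1 \<le> \<Delta> * real p"
      using one_le_of_exp_sum_bound[of p X \<Delta>] main X \<open>\<Delta> \<ge> 0\<close> \<open>p > 0\<close> bound by (simp add: N_def)
    then have "1 ^ 3 \<le> (d * s) ^ 3"
      by (simp add: power_mult_distrib cubes)
    then have ds: "1 \<le> d * s"
      using d s by (subst (asm) power_mono_iff) auto
    have "d ^ 3 \<le> 1 ^ 3"
      using main by (simp add: cubes)
    then have "d \<le> 1"
      using d by (subst (asm) power_mono_iff) auto
    \<comment> \<open>From \<open>d \<le> 1\<close> and \<open>t \<le> s\<close> follows
      \<open>K \<le> s ^ 3 = p\<close>; rounding up preserves this since \<open>p\<close> is an
      integer.\<close>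
    then have "K \<le> (1 * s)\<^sup>2 * s"
      unfolding K_def using d s t ts by (intro mult_mono power_mono) auto
    also have "\<dots> = real p"
      by (simp flip: cubes add: power2_eq_square power3_eq_cube)
    finally have "H \<le> int p"
      unfolding H_def by (simp add: ceiling_le_iff)
    have "1 * 1 \<le> K"
      unfolding K_def using ds t by (intro mult_mono) auto
    then have K: "K \<ge> 1"
      by simp
    then have "1 \<le> H"
      unfolding H_def by linarith
    \<comment> \<open>As \<open>K \<ge> 1\<close>, rounding up costs at most a factor 2.\<close>
    have HK: "K \<le> real_of_int H" "real_of_int H \<le> 2 * K"
      unfolding H_def using K by linarith+
    have "d > 0"
      using ds d by (cases "d = 0") auto
    have "real_of_int T / K = (t / (d * s))\<^sup>2"
      using t \<open>d > 0\<close> s by (simp flip: cubes add: K_def field_simps power2_eq_square power3_eq_cube)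
    then have sqrt_K: "sqrt (real_of_int T / K) = t / (d * s)"
      using t \<open>d > 0\<close> s by simp
    have "K / real p = R"
      using s by (simp flip: cubes add: K_def R_def field_simps power2_eq_square power3_eq_cube)
    then have "real_of_int H / real p \<le> 2 * R"
      using HK(2) \<open>p > 0\<close> by (simp add: field_simps)
    then have "N * real_of_int H / real p \<le> N * (2 * R)"
      using mult_left_mono[OF _ N] by fastforce
    moreover have "\<Delta> * sqrt (real_of_int T / real_of_int H) \<le> R"
    proof -
      have "\<Delta> * sqrt (real_of_int T / real_of_int H) \<le> \<Delta> * sqrt (real_of_int T / K)"
        using HK(1) K T \<open>\<Delta> \<ge> 0\<close> by (intro mult_left_mono real_sqrt_le_mono divide_left_mono) auto
      also have "\<dots> = R"
        using s \<open>d > 0\<close> unfolding sqrt_K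
        by (simp flip: cubes(2) add: R_def field_simps power2_eq_square power3_eq_cube)
      finally show ?thesis .
    qed
    then have "N * \<Delta> * (sqrt (real_of_int T / real_of_int H) + 1) \<le> N * (R + \<Delta>)"
      using N by (simp add: distrib_left mult.assoc mult_left_mono)
    moreover have "\<bar>real (J3 p X S T) - N * real_of_int T / real p\<bar>
      \<le> N * real_of_int H / real p + N * \<Delta> * (sqrt (real_of_int T / real_of_int H) + 1)"
      unfolding N_def
      using J3_approx[OF fin \<open>p > 0\<close> \<open>1 \<le> H\<close> \<open>H \<le> int p\<close> T, of "N * \<Delta>" S] N \<open>\<Delta> \<ge> 0\<close> bound
      by (simp add: N_def)
    \<comment> \<open>The constant 3 counts the copies of \<open>N * R\<close>: two from the rounded
      width and one from the square root.\<close>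
    moreover have "N * (2 * R) + N * (R + \<Delta>) \<le> 3 * (N * R + N * \<Delta>)"
      using N \<open>\<Delta> \<ge> 0\<close> by (simp add: algebra_simps)
    ultimately show ?thesis
      by linarith
  qed
  then show ?thesis
    unfolding rhs by (simp add: N_def)
qed

theorem theorem4:
  shows "\<exists>C::real. C > 0 \<and>
    (\<forall>(p::nat) (X::int set) (\<Delta>::real) (S::int) (T::int).
      prime p \<longrightarrow> X \<subseteq> {0..int p - 1} \<longrightarrow> \<Delta> \<ge> 0 \<longrightarrow>
      max_exp_sum p X \<le> real (card X) * \<Delta> \<longrightarrow>
      1 \<le> T \<longrightarrow> T \<le> int p \<longrightarrow>
      \<bar>real (J3 p X S T) - real (card X) * real_of_int T / real p\<bar>
        \<le> C * (real (card X) * real_of_int T powr (1/3) * \<Delta> powr (2/3) / real p powr (1/3)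
               + real (card X) * \<Delta>))"
  by (rule exI[of _ 3]) (use J3_bound in auto)

end
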